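(* Let $A\in\mathbb{R}^{d\times d}$ be orthogonal, $B\in\mathbb{R}^{d\times m}$, and suppose $(A,B)$ is reachable in $k$ steps, i.e. $\operatorname{rank}[B\ AB\ \cdots\ A^{k-1}B]=d$. Let $(w_t)_{t\in\mathbb{N}_0}$ be mutually independent $\mathbb{R}^d$-valued random vectors with $\mathsf{E}[w_t]=0$, $\mathsf{E}[w_tw_t^{\mathrm T}]=Q_t$, and $\mathsf{E}[\|w_t\|^4]\le C_4$ for all $t$, for some $C_4>0$. Consider $x_{t+1}=Ax_t+Bu_t+w_t$ with $x_t\in\mathbb{R}^d$, $u_t\in\mathbb{R}^m$. Then there exist a constant $\rho>0$ and measurable maps $f_0,\ldots,f_{k-1}:\mathbb{R}^d\to\mathbb{R}^m$ with $\|f_i(x)\|\le\rho$ for all $x\in\mathbb{R}^d$ and all $i$, such that the closed-loop system $$x_{t+1}=Ax_t+Bf_{t\bmod k}\bigl(x_{\lfloor t/k\rfloor k}\bigr)+w_t,\qquad x_0=x,$$ satisfies $\sup_{t\in\mathbb{N}_0}\mathsf{E}_x[\|x_t\|^2]<\infty$ for every $x\in\mathbb{R}^d$.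
   Context: $\|\cdot\|$ is the Euclidean norm; $\mathsf{E}_x$ is expectation given $x_0=x$. The policy applies, within each time block $\{\tau k,\ldots,(\tau+1)k-1\}$, the controls $f_0,\ldots,f_{k-1}$ in order, each evaluated at the state $x_{\tau k}$ at the start of the block. *)

theory Defs
  imports "HOL-Analysis.Analysis" "HOL-Probability.Probability"
begin

text \<open>Matrix power A^n (square matrices over real^'d).\<close>
primrec matpow :: "real^'d^'d \<Rightarrow> nat \<Rightarrow> real^'d^'d" where
  "matpow A 0 = mat 1"
| "matpow A (Suc n) = A ** matpow A n"

text \<open>Rank of the block matrix [B, AB, ..., A^(k-1) B]: the dimension of the span
  of all its columns, i.e. of the union of the columns of the blocks A^i B, i < k.\<close>
definition reach_rank :: "real^'d^'d \<Rightarrow> real^'m^'d \<Rightarrow> nat \<Rightarrow> nat" where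
  "reach_rank A B k = dim (\<Union>i<k. columns (matpow A i ** B))"

definition reachable_in :: "real^'d^'d \<Rightarrow> real^'m^'d \<Rightarrow> nat \<Rightarrow> bool" where
  "reachable_in A B k \<longleftrightarrow> reach_rank A B k = CARD('d)"

text \<open>Closed-loop state: x_0 = x, and
  x_(t+1) = A x_t + B f_(t mod k) (x_(floor(t/k) k)) + w_t.\<close>
function (sequential) closed_loop ::
  "real^'d^'d \<Rightarrow> real^'m^'d \<Rightarrow> nat \<Rightarrow> (nat \<Rightarrow> real^'d \<Rightarrow> real^'m)
    \<Rightarrow> (nat \<Rightarrow> 'a \<Rightarrow> real^'d) \<Rightarrow> real^'d \<Rightarrow> nat \<Rightarrow> 'a \<Rightarrow> real^'d" where
  "closed_loop A B k f w x 0 \<omega> = x"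
| "closed_loop A B k f w x (Suc t) \<omega> =
     A *v closed_loop A B k f w x t \<omega>
     + B *v f (t mod k) (closed_loop A B k f w x ((t div k) * k) \<omega>)
     + w t \<omega>"
  by pat_completeness auto
termination
  by (relation "Wellfounded.measure (\<lambda>(A,B,k,f,w,x,t,\<omega>). t)")
     (auto simp: less_Suc_eq_le div_times_less_eq_dividend)

end

theory Submission
  imports Defs
begin

text \<open>
  With orthogonal \<open>A\<close> neither the free motion nor the propagation of the noise changes norms.
  Reachability in \<open>k\<close> steps provides bounded controls which, applied over a block of \<open>k\<close>
  steps, move the noise-free state by the vector \<open>-min 1 (r / \<parallel>A\<^sup>k x\<parallel>) A\<^sup>k x\<close>. Hence
  \<open>Z\<^sub>n = \<parallel>x\<^sub>n\<^sub>k\<parallel>\<close> satisfies \<open>Z\<^sub>n\<^sub>+\<^sub>1 \<le> max (Z\<^sub>n - r) 0 + D\<^sub>n\<close>, where \<open>D\<^sub>n\<close> is the total norm of the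
  noise in block \<open>n\<close>: it is independent of \<open>Z\<^sub>0, \<dots>, Z\<^sub>n\<close> and has bounded fourth moment.

  For \<open>r\<close> large compared with that moment, \<open>z\<^sup>g\<^sup>+\<^sup>1\<close> decreases in expectation by at least \<open>z\<^sup>g\<close>
  at every step above \<open>r\<close> (\<open>g \<le> 3\<close>). Summing these drift inequalities along an excursion
  above \<open>r\<close> with polynomial weights shows that an excursion survives \<open>L\<close> steps with probability
  \<open>O(L\<^sup>-\<^sup>4)\<close>, and that \<open>Z\<^sup>2\<close> at its end has mean \<open>O(L\<^sup>-\<^sup>2)\<close>. As \<open>Z\<^sub>n > r\<close> forces \<open>n\<close> to lie in
  an excursion started at some earlier time, summing over the starting time bounds
  \<open>E Z\<^sub>n\<^sup>2\<close> uniformly, and the states inside a block are controlled by the block boundaries.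
\<close>

section \<open>Elementary inequalities\<close>

lemma power2_sum3_le:
  fixes a b c :: real
  shows "(a + b + c)^2 \<le> 3 * (a^2 + b^2 + c^2)"
proof -
  have "0 \<le> (a - b)^2 + (b - c)^2 + (c - a)^2" by simp
  thus ?thesis by (simp add: power2_eq_square algebra_simps)
qed

lemma power4_sum_le:
  fixes y :: "'i \<Rightarrow> real"
  shows "(\<Sum>i\<in>I. y i)^4 \<le> real (card I)^3 * (\<Sum>i\<in>I. y i ^ 4)"
proof -
  have 1: "(\<Sum>i\<in>I. y i)^2 \<le> (\<Sum>i\<in>I. (y i)^2) * card I"
    by (rule sum_squared_le_sum_of_squares)
  have 2: "(\<Sum>i\<in>I. (y i)^2)^2 \<le> (\<Sum>i\<in>I. ((y i)^2)^2) * card I"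
    by (rule sum_squared_le_sum_of_squares)
  have "(\<Sum>i\<in>I. y i)^4 = ((\<Sum>i\<in>I. y i)^2)^2" by simp
  also have "\<dots> \<le> ((\<Sum>i\<in>I. (y i)^2) * card I)^2" using 1 by (intro power_mono) auto
  also have "\<dots> = (\<Sum>i\<in>I. (y i)^2)^2 * (real (card I))^2" by (simp add: power_mult_distrib)
  also have "\<dots> \<le> ((\<Sum>i\<in>I. ((y i)^2)^2) * card I) * (real (card I))^2"
    using 2 by (intro mult_right_mono) auto
  also have "\<dots> = real (card I)^3 * (\<Sum>i\<in>I. y i ^ 4)"
    by (simp add: power2_eq_square power3_eq_cube power4_eq_xxxx mult.assoc)
  finally show ?thesis .
qed

lemma power4_add_le:
  fixes a b :: real
  shows "(a + b)^4 \<le> 8 * (a^4 + b^4)"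
  using power4_sum_le[of "\<lambda>i. if i then a else b" UNIV] by (simp add: UNIV_bool add.commute)

lemma sum_of_cubes: "4 * (\<Sum>l<n. (l + 1)^3) = n^2 * (n + 1 :: nat)^2"
proof (induction n)
  case (Suc n)
  have "4 * (\<Sum>l<Suc n. (l + 1)^3) = n^2 * (n + 1)^2 + 4 * (n + 1)^3"
    using Suc by simp
  also have "\<dots> = (Suc n)^2 * (Suc n + 1)^2"
    by (simp add: power2_eq_square power3_eq_cube algebra_simps)
  finally show ?case .
qed simp

lemma sum_inverse_squares_le: "(\<Sum>L<n. 1 / (real L + 1)^2) \<le> 2 - 2 / (real n + 1)"
proof (induction n)
  case (Suc n)
  have "1 / (real n + 1)^2 \<le> 2 / (real n + 1) - 2 / (real n + 2)"
    by (simp add: divide_simps power2_eq_square)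
  with Suc show ?case by (simp add: add.commute)
qed simp

text \<open>The polynomial inequality behind the drift of \<open>z\<^sup>g\<^sup>+\<^sup>1\<close>, with \<open>z = a + r\<close> and \<open>\<mu>\<close> bounding the
  moments of the increment.\<close>
lemma binomial_drift_ineq:
  fixes a \<mu> r :: real
  assumes a: "0 \<le> a" and \<mu>: "0 \<le> \<mu>" and r: "\<mu> + 1 \<le> r"
  shows "a^(Suc g) + (\<Sum>k\<le>g. of_nat (Suc g choose k) * a^k * \<mu>) + (a + r)^g \<le> (a + r)^(Suc g)"
proof -
  have r1: "1 \<le> r" using \<mu> r by linarith
  have "(\<Sum>k\<le>g. of_nat (Suc g choose k) * a^k * \<mu>) + (a + r)^g
      = (\<Sum>k\<le>g. of_nat (Suc g choose k) * a^k * \<mu> + of_nat (g choose k) * a^k * r^(g - k))"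
    by (simp add: binomial_ring[of a r g] sum.distrib)
  also have "\<dots> \<le> (\<Sum>k\<le>g. of_nat (Suc g choose k) * a^k * r^(Suc g - k))"
  proof (rule sum_mono)
    fix k assume k: "k \<in> {..g}"
    define c where "c = real (Suc g choose k)"
    have c: "real (g choose k) \<le> c" unfolding c_def
      using binomial_right_mono[of g "Suc g" k] by simp
    have rj: "1 \<le> r^(g - k)" using r1 by simp
    have "\<mu> + r^(g - k) \<le> r^(g - k) * r"
      using mult_right_mono[OF rj, of "r - 1"] r r1 by (simp add: algebra_simps)
    have "c * \<mu> + real (g choose k) * r^(g - k) \<le> c * \<mu> + c * r^(g - k)"
      using c rj by (intro add_left_mono mult_right_mono) auto
    also have "\<dots> \<le> c * (r^(g - k) * r)"
      using \<open>\<mu> + r^(g - k) \<le> r^(g - k) * r\<close> c_def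
      by (simp add: distrib_left[symmetric] mult_left_mono)
    finally have "c * \<mu> + real (g choose k) * r^(g - k) \<le> c * (r^(g - k) * r)" .
    hence "a^k * (c * \<mu> + real (g choose k) * r^(g - k)) \<le> a^k * (c * (r^(g - k) * r))"
      using a by (intro mult_left_mono) auto
    moreover have "Suc g - k = Suc (g - k)" using k by auto
    ultimately show "of_nat (Suc g choose k) * a^k * \<mu> + of_nat (g choose k) * a^k * r^(g - k)
        \<le> of_nat (Suc g choose k) * a^k * r^(Suc g - k)"
      by (simp add: c_def algebra_simps)
  qed
  moreover have "(a + r)^(Suc g)
      = a^(Suc g) + (\<Sum>k\<le>g. of_nat (Suc g choose k) * a^k * r^(Suc g - k))"
    unfolding binomial_ring[of a r "Suc g"] by (simp add: sum.atMost_Suc)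
  ultimately show ?thesis by linarith
qed

text \<open>Abel summation of the drift inequality \<open>x\<^sub>L\<^sub>+\<^sub>1 + y\<^sub>L \<le> x\<^sub>L\<close> against the weights \<open>u\<close>.\<close>
lemma weighted_drift_summation:
  fixes x y u v :: "nat \<Rightarrow> ennreal"
  assumes xy: "\<And>L. x (Suc L) + y L \<le> x L" and uv: "\<And>L. u (Suc L) \<le> u L + v L"
  shows "u N * x N + (\<Sum>L<N. u (Suc L) * y L) \<le> u 0 * x 0 + (\<Sum>L<N. v L * x L)"
proof (induction N)
  case (Suc N)
  have "u (Suc N) * x (Suc N) + (\<Sum>L<Suc N. u (Suc L) * y L)
      = u (Suc N) * (x (Suc N) + y N) + (\<Sum>L<N. u (Suc L) * y L)"
    by (simp add: distrib_left ac_simps)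
  also have "\<dots> \<le> (u N + v N) * x N + (\<Sum>L<N. u (Suc L) * y L)"
    using xy uv by (intro add_right_mono mult_mono) auto
  also have "\<dots> = (u N * x N + (\<Sum>L<N. u (Suc L) * y L)) + v N * x N"
    by (simp only: distrib_right add.assoc add.commute add.left_commute)
  also have "\<dots> \<le> u 0 * x 0 + (\<Sum>L<Suc N. v L * x L)"
    using Suc by (simp add: add.assoc add_right_mono)
  finally show ?case .
qed simp

lemma ennreal_le_mult_inverse:
  fixes b K :: ennreal
  assumes "of_nat n * b \<le> K" and "0 < n"
  shows "b \<le> K * ennreal (1 / real n)"
proof -
  have "ennreal (1 / real n) * of_nat n = 1"
    using assms(2) by (simp add: ennreal_of_nat_eq_real_of_nat ennreal_mult[symmetric])
  hence "b = ennreal (1 / real n) * (of_nat n * b)" by (simp add: mult.assoc[symmetric])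
  also have "\<dots> \<le> ennreal (1 / real n) * K" using assms(1) by (rule mult_left_mono) simp
  finally show ?thesis by (simp add: mult.commute)
qed

section \<open>Moments and independence\<close>

lemma (in prob_space) nn_integral_power_le_one_plus:
  assumes "i \<le> p" and "\<And>\<omega>. 0 \<le> X \<omega>" and [measurable]: "X \<in> borel_measurable M"
  shows "(\<integral>\<^sup>+\<omega>. ennreal (X \<omega> ^ i) \<partial>M) \<le> 1 + (\<integral>\<^sup>+\<omega>. ennreal (X \<omega> ^ p) \<partial>M)"
proof -
  have "X \<omega> ^ i \<le> 1 + X \<omega> ^ p" for \<omega>
  proof (cases "X \<omega> \<le> 1")
    case True
    thus ?thesis using assms(2)[of \<omega>] by (smt (verit) power_le_one zero_le_power)
  next
    case False
    hence "X \<omega> ^ i \<le> X \<omega> ^ p" using assms(1) by (intro power_increasing) auto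
    thus ?thesis by simp
  qed
  hence "ennreal (X \<omega> ^ i) \<le> 1 + ennreal (X \<omega> ^ p)" for \<omega>
    using assms(2)[of \<omega>] by (metis ennreal_leI ennreal_plus ennreal_1 zero_le_one zero_le_power)
  hence "(\<integral>\<^sup>+\<omega>. ennreal (X \<omega> ^ i) \<partial>M) \<le> (\<integral>\<^sup>+\<omega>. 1 + ennreal (X \<omega> ^ p) \<partial>M)"
    by (intro nn_integral_mono)
  also have "\<dots> = 1 + (\<integral>\<^sup>+\<omega>. ennreal (X \<omega> ^ p) \<partial>M)"
    by (subst nn_integral_add) (auto simp: emeasure_space_1)
  finally show ?thesis .
qed

lemma (in prob_space) indep_var_nn_integral:
  assumes I: "indep_var S X T Y"
    and F[measurable]: "F \<in> borel_measurable (S \<Otimes>\<^sub>M T)"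
  shows "(\<integral>\<^sup>+\<omega>. F (X \<omega>, Y \<omega>) \<partial>M) = (\<integral>\<^sup>+\<omega>. \<integral>\<^sup>+\<omega>'. F (X \<omega>, Y \<omega>') \<partial>M \<partial>M)"
proof -
  have X[measurable]: "X \<in> measurable M S" and Y[measurable]: "Y \<in> measurable M T"
    and D: "distr M S X \<Otimes>\<^sub>M distr M T Y = distr M (S \<Otimes>\<^sub>M T) (\<lambda>x. (X x, Y x))"
    using I unfolding indep_var_distribution_eq by auto
  interpret T: prob_space "distr M T Y" by (rule prob_space_distr) simp
  have "(\<integral>\<^sup>+\<omega>. F (X \<omega>, Y \<omega>) \<partial>M) = (\<integral>\<^sup>+z. F z \<partial>(distr M S X \<Otimes>\<^sub>M distr M T Y))"
    by (simp add: D nn_integral_distr)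
  also have "\<dots> = (\<integral>\<^sup>+a. \<integral>\<^sup>+b. F (a, b) \<partial>distr M T Y \<partial>distr M S X)"
    by (subst T.nn_integral_fst[symmetric]) auto
  also have "\<dots> = (\<integral>\<^sup>+\<omega>. \<integral>\<^sup>+\<omega>'. F (X \<omega>, Y \<omega>') \<partial>M \<partial>M)"
    by (subst nn_integral_distr, simp, simp, intro nn_integral_cong, subst nn_integral_distr)
       (auto intro!: measurable_Pair2[OF F] measurable_space[OF X])
  finally show ?thesis .
qed

lemma (in prob_space) nn_integral_binomial_le:
  assumes a: "0 \<le> a" and \<mu>: "0 \<le> \<mu>" and X: "\<And>\<omega>. 0 \<le> X \<omega>"
    and [measurable]: "X \<in> borel_measurable M"
    and mom: "\<And>j. 0 < j \<Longrightarrow> j \<le> p \<Longrightarrow> (\<integral>\<^sup>+\<omega>. ennreal (X \<omega> ^ j) \<partial>M) \<le> ennreal \<mu>"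
  shows "(\<integral>\<^sup>+\<omega>. ennreal ((a + X \<omega>)^p) \<partial>M)
    \<le> ennreal (a^p + (\<Sum>k<p. of_nat (p choose k) * a^k * \<mu>))"
proof -
  have expand: "ennreal ((a + X \<omega>)^p)
      = ennreal (a^p) + (\<Sum>k<p. ennreal (of_nat (p choose k) * a^k) * ennreal (X \<omega> ^ (p - k)))"
    for \<omega>
  proof -
    have "(a + X \<omega>)^p = a^p + (\<Sum>k<p. of_nat (p choose k) * a^k * X \<omega> ^ (p - k))"
      by (simp add: binomial_ring lessThan_Suc_atMost[symmetric])
    hence "ennreal ((a + X \<omega>)^p)
        = ennreal (a^p) + ennreal (\<Sum>k<p. of_nat (p choose k) * a^k * X \<omega> ^ (p - k))"
      using a X[of \<omega>] by (simp add: ennreal_plus sum_nonneg)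
    also have "ennreal (\<Sum>k<p. of_nat (p choose k) * a^k * X \<omega> ^ (p - k))
        = (\<Sum>k<p. ennreal (of_nat (p choose k) * a^k * X \<omega> ^ (p - k)))"
      using a X[of \<omega>] by (intro sum_ennreal[symmetric]) auto
    also have "\<dots> = (\<Sum>k<p. ennreal (of_nat (p choose k) * a^k) * ennreal (X \<omega> ^ (p - k)))"
      using a X[of \<omega>] by (intro sum.cong refl ennreal_mult) auto
    finally show ?thesis .
  qed
  have "(\<integral>\<^sup>+\<omega>. ennreal ((a + X \<omega>)^p) \<partial>M)
      = ennreal (a^p) + (\<Sum>k<p. ennreal (of_nat (p choose k) * a^k) * (\<integral>\<^sup>+\<omega>. ennreal (X \<omega> ^ (p - k)) \<partial>M))"
    unfolding expand by (subst nn_integral_add) (auto simp: nn_integral_sum nn_integral_cmult emeasure_space_1)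
  also have "\<dots> \<le> ennreal (a^p) + (\<Sum>k<p. ennreal (of_nat (p choose k) * a^k) * ennreal \<mu>)"
    by (intro add_left_mono sum_mono mult_left_mono mom) auto
  also have "\<dots> = ennreal (a^p) + (\<Sum>k<p. ennreal (of_nat (p choose k) * a^k * \<mu>))"
    using a \<mu> by (intro arg_cong2[where f="(+)"] sum.cong refl ennreal_mult[symmetric]) auto
  also have "\<dots> = ennreal (a^p + (\<Sum>k<p. of_nat (p choose k) * a^k * \<mu>))"
    using a \<mu> by (simp add: sum_ennreal ennreal_plus[symmetric] sum_nonneg del: ennreal_plus)
  finally show ?thesis .
qed

section \<open>A drift criterion for Lindley-type recursions\<close>

text \<open>The history \<open>Z\<^sub>0, \<dots>, Z\<^sub>n\<close> is encoded as the sequence \<open>\<lambda>i. Z (min i n)\<close>, so that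
  independence of \<open>D\<^sub>n\<close> from it can be stated as a splitting of integrals over the product.\<close>
locale lindley_drift = prob_space M for M :: "'a measure" +
  fixes Z D :: "nat \<Rightarrow> 'a \<Rightarrow> real" and r z0 C :: real
  assumes Z_measurable[measurable]: "\<And>n. Z n \<in> borel_measurable M"
    and D_measurable[measurable]: "\<And>n. D n \<in> borel_measurable M"
    and Z_nonneg: "\<And>n \<omega>. 0 \<le> Z n \<omega>" and D_nonneg: "\<And>n \<omega>. 0 \<le> D n \<omega>"
    and Z_0: "\<And>\<omega>. Z 0 \<omega> = z0"
    and Z_Suc_le: "\<And>n \<omega>. Z (Suc n) \<omega> \<le> max (Z n \<omega> - r) 0 + D n \<omega>"
    and D_fourth_moment: "\<And>n. (\<integral>\<^sup>+\<omega>. ennreal (D n \<omega> ^ 4) \<partial>M) \<le> ennreal C"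
    and C_nonneg: "0 \<le> C" and r_ge: "C + 2 \<le> r"
    and D_indep_history: "\<And>n F. F \<in> borel_measurable (PiM UNIV (\<lambda>_. borel) \<Otimes>\<^sub>M borel) \<Longrightarrow>
        (\<integral>\<^sup>+\<omega>. F (\<lambda>i. Z (min i n) \<omega>, D n \<omega>) \<partial>M)
          = (\<integral>\<^sup>+\<omega>. \<integral>\<^sup>+\<omega>'. F (\<lambda>i. Z (min i n) \<omega>, D n \<omega>') \<partial>M \<partial>M)"
begin

lemma r_nonneg: "0 \<le> r"
  using r_ge C_nonneg by linarith

lemma history_measurable[measurable]:
  "(\<lambda>\<omega> i. Z (min i n) \<omega>) \<in> measurable M (PiM UNIV (\<lambda>_. borel))"
  by (rule measurable_PiM_single') auto

lemma power_drift:
  assumes z: "r \<le> z" and g: "g \<le> 3"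
  shows "(\<integral>\<^sup>+\<omega>'. ennreal ((max (z - r) 0 + D n \<omega>')^(Suc g) + z^g) \<partial>M) \<le> ennreal (z^(Suc g))"
proof -
  define a where "a = z - r"
  have a: "0 \<le> a" and z_eq: "z = a + r" and "max (z - r) 0 = a"
    using z by (auto simp: a_def)
  have "(\<integral>\<^sup>+\<omega>'. ennreal ((max (z - r) 0 + D n \<omega>')^(Suc g) + z^g) \<partial>M)
      = (\<integral>\<^sup>+\<omega>'. ennreal ((a + D n \<omega>')^(Suc g)) \<partial>M) + ennreal (z^g)"
  proof -
    have "(\<integral>\<^sup>+\<omega>'. ennreal ((max (z - r) 0 + D n \<omega>')^(Suc g) + z^g) \<partial>M)
        = (\<integral>\<^sup>+\<omega>'. ennreal ((a + D n \<omega>')^(Suc g)) + ennreal (z^g) \<partial>M)"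
      using a z r_nonneg D_nonneg unfolding \<open>max (z - r) 0 = a\<close>
      by (intro nn_integral_cong) (simp add: ennreal_plus)
    thus ?thesis by (subst (asm) nn_integral_add) (auto simp: emeasure_space_1)
  qed
  also have "\<dots> \<le> ennreal (a^(Suc g) + (\<Sum>k<Suc g. of_nat (Suc g choose k) * a^k * (1 + C))) + ennreal (z^g)"
  proof (intro add_right_mono nn_integral_binomial_le)
    fix j :: nat assume "j \<le> Suc g"
    hence "(\<integral>\<^sup>+\<omega>. ennreal (D n \<omega> ^ j) \<partial>M) \<le> 1 + (\<integral>\<^sup>+\<omega>. ennreal (D n \<omega> ^ 4) \<partial>M)"
      using g D_nonneg by (intro nn_integral_power_le_one_plus) auto
    also have "\<dots> \<le> ennreal (1 + C)"
      using D_fourth_moment[of n] C_nonneg by (simp add: ennreal_plus add_left_mono)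
    finally show "(\<integral>\<^sup>+\<omega>. ennreal (D n \<omega> ^ j) \<partial>M) \<le> ennreal (1 + C)" .
  qed (use a C_nonneg D_nonneg in auto)
  also have "\<dots> = ennreal (a^(Suc g) + (\<Sum>k<Suc g. of_nat (Suc g choose k) * a^k * (1 + C)) + z^g)"
    using a C_nonneg z r_nonneg by (intro ennreal_plus[symmetric] add_nonneg_nonneg sum_nonneg) auto
  also have "\<dots> \<le> ennreal (z^(Suc g))"
    using binomial_drift_ineq[OF a, of "1 + C" r g] C_nonneg r_ge
    by (intro ennreal_leI) (simp add: lessThan_Suc_atMost z_eq)
  finally show ?thesis .
qed

lemma D_square_moment: "(\<integral>\<^sup>+\<omega>. ennreal (D n \<omega> ^ 2) \<partial>M) \<le> 1 + ennreal C"
proof -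
  have "(\<integral>\<^sup>+\<omega>. ennreal (D n \<omega> ^ 2) \<partial>M) \<le> 1 + (\<integral>\<^sup>+\<omega>. ennreal (D n \<omega> ^ 4) \<partial>M)"
    by (rule nn_integral_power_le_one_plus) (auto simp: D_nonneg)
  also have "\<dots> \<le> 1 + ennreal C" by (rule add_left_mono[OF D_fourth_moment])
  finally show ?thesis .
qed

lemma history_weighted_drift:
  fixes h :: "(nat \<Rightarrow> real) \<Rightarrow> ennreal"
  assumes [measurable]: "h \<in> borel_measurable (PiM UNIV (\<lambda>_. borel))"
    and h_above: "\<And>\<eta>. h \<eta> \<noteq> 0 \<Longrightarrow> r \<le> \<eta> n" and g: "g \<le> 3"
  shows "(\<integral>\<^sup>+\<omega>. h (\<lambda>i. Z (min i n) \<omega>) * ennreal (Z (Suc n) \<omega> ^ Suc g) \<partial>M)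
       + (\<integral>\<^sup>+\<omega>. h (\<lambda>i. Z (min i n) \<omega>) * ennreal (Z n \<omega> ^ g) \<partial>M)
     \<le> (\<integral>\<^sup>+\<omega>. h (\<lambda>i. Z (min i n) \<omega>) * ennreal (Z n \<omega> ^ Suc g) \<partial>M)"
proof -
  define F where "F = (\<lambda>(\<eta>::nat \<Rightarrow> real, d::real).
    h \<eta> * ennreal ((max (\<eta> n - r) 0 + d)^(Suc g) + (\<eta> n)^g))"
  have "F \<in> borel_measurable (PiM UNIV (\<lambda>_. borel) \<Otimes>\<^sub>M borel)"
    unfolding F_def by measurable
  note split = D_indep_history[OF this]
  have "(\<integral>\<^sup>+\<omega>. h (\<lambda>i. Z (min i n) \<omega>) * ennreal (Z (Suc n) \<omega> ^ Suc g) \<partial>M)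
       + (\<integral>\<^sup>+\<omega>. h (\<lambda>i. Z (min i n) \<omega>) * ennreal (Z n \<omega> ^ g) \<partial>M)
     \<le> (\<integral>\<^sup>+\<omega>. h (\<lambda>i. Z (min i n) \<omega>) * ennreal ((max (Z n \<omega> - r) 0 + D n \<omega>) ^ Suc g) \<partial>M)
       + (\<integral>\<^sup>+\<omega>. h (\<lambda>i. Z (min i n) \<omega>) * ennreal (Z n \<omega> ^ g) \<partial>M)"
    by (intro add_right_mono nn_integral_mono mult_left_mono ennreal_leI power_mono Z_Suc_le Z_nonneg)
       auto
  also have "\<dots> = (\<integral>\<^sup>+\<omega>. F (\<lambda>i. Z (min i n) \<omega>, D n \<omega>) \<partial>M)"
    unfolding F_def using Z_nonneg D_nonneg
    by (subst nn_integral_add[symmetric]) (auto intro!: nn_integral_cong simp: ennreal_plus distrib_left)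
  also have "\<dots> = (\<integral>\<^sup>+\<omega>. h (\<lambda>i. Z (min i n) \<omega>) *
       (\<integral>\<^sup>+\<omega>'. ennreal ((max (Z n \<omega> - r) 0 + D n \<omega>')^(Suc g) + (Z n \<omega>)^g) \<partial>M) \<partial>M)"
    unfolding split unfolding F_def
    by (intro nn_integral_cong, subst nn_integral_cmult[symmetric]) auto
  also have "\<dots> \<le> (\<integral>\<^sup>+\<omega>. h (\<lambda>i. Z (min i n) \<omega>) * ennreal (Z n \<omega> ^ Suc g) \<partial>M)"
  proof (intro nn_integral_mono)
    fix \<omega>
    show "h (\<lambda>i. Z (min i n) \<omega>) *
        (\<integral>\<^sup>+\<omega>'. ennreal ((max (Z n \<omega> - r) 0 + D n \<omega>')^(Suc g) + (Z n \<omega>)^g) \<partial>M)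
      \<le> h (\<lambda>i. Z (min i n) \<omega>) * ennreal (Z n \<omega> ^ Suc g)"
    proof (cases "h (\<lambda>i. Z (min i n) \<omega>) = 0")
      case False
      thus ?thesis using h_above[of "\<lambda>i. Z (min i n) \<omega>"] g
        by (intro mult_left_mono power_drift) auto
    qed simp
  qed
  finally show ?thesis .
qed

definition excursion :: "nat \<Rightarrow> real \<Rightarrow> nat \<Rightarrow> 'a \<Rightarrow> bool" where
  "excursion j S L \<omega> \<longleftrightarrow> Z j \<omega> \<le> S \<and> (\<forall>l. j < l \<and> l \<le> j + L \<longrightarrow> r < Z l \<omega>)"

definition excursion_moment :: "nat \<Rightarrow> real \<Rightarrow> nat \<Rightarrow> nat \<Rightarrow> ennreal" where
  "excursion_moment j S g L =
    (\<integral>\<^sup>+\<omega>. (if excursion j S (Suc L) \<omega> then ennreal (Z (j + Suc L) \<omega> ^ g) else 0) \<partial>M)"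

lemma excursion_measurable[measurable]: "Measurable.pred M (excursion j S L)"
  unfolding excursion_def by measurable

lemma excursion_moment_drift:
  assumes "g \<le> 3"
  shows "excursion_moment j S (Suc g) (Suc L) + excursion_moment j S g L
    \<le> excursion_moment j S (Suc g) L"
proof -
  define h where "h = (\<lambda>\<eta>::nat \<Rightarrow> real.
    if \<eta> j \<le> S \<and> (\<forall>l\<in>{j<..j + Suc L}. r < \<eta> l) then (1::ennreal) else 0)"
  have "h \<in> borel_measurable (PiM UNIV (\<lambda>_. borel))"
    unfolding h_def by measurable
  moreover have "r \<le> \<eta> (j + Suc L)" if "h \<eta> \<noteq> 0" for \<eta>
    using that unfolding h_def by (auto split: if_splits intro: less_imp_le)
  ultimately have drift:
    "(\<integral>\<^sup>+\<omega>. h (\<lambda>i. Z (min i (j + Suc L)) \<omega>) * ennreal (Z (Suc (j + Suc L)) \<omega> ^ Suc g) \<partial>M)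
       + (\<integral>\<^sup>+\<omega>. h (\<lambda>i. Z (min i (j + Suc L)) \<omega>) * ennreal (Z (j + Suc L) \<omega> ^ g) \<partial>M)
     \<le> (\<integral>\<^sup>+\<omega>. h (\<lambda>i. Z (min i (j + Suc L)) \<omega>) * ennreal (Z (j + Suc L) \<omega> ^ Suc g) \<partial>M)"
    using assms by (intro history_weighted_drift) auto
  have h_eq: "h (\<lambda>i. Z (min i (j + Suc L)) \<omega>) = (if excursion j S (Suc L) \<omega> then 1 else 0)" for \<omega>
    unfolding h_def excursion_def by (auto simp: min_def)
  have moment_eq: "(\<integral>\<^sup>+\<omega>. h (\<lambda>i. Z (min i (j + Suc L)) \<omega>) * ennreal (Z (j + Suc L) \<omega> ^ p) \<partial>M)
      = excursion_moment j S p L" for p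
    unfolding excursion_moment_def h_eq by (intro nn_integral_cong) simp
  have "excursion_moment j S (Suc g) (Suc L)
      \<le> (\<integral>\<^sup>+\<omega>. h (\<lambda>i. Z (min i (j + Suc L)) \<omega>) * ennreal (Z (Suc (j + Suc L)) \<omega> ^ Suc g) \<partial>M)"
    unfolding excursion_moment_def h_eq by (intro nn_integral_mono) (auto simp: excursion_def)
  hence "excursion_moment j S (Suc g) (Suc L) + excursion_moment j S g L
      \<le> (\<integral>\<^sup>+\<omega>. h (\<lambda>i. Z (min i (j + Suc L)) \<omega>) * ennreal (Z (Suc (j + Suc L)) \<omega> ^ Suc g) \<partial>M)
        + excursion_moment j S g L"
    by (rule add_right_mono)
  also have "\<dots> \<le> excursion_moment j S (Suc g) L"
    using drift unfolding moment_eq .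
  finally show ?thesis .
qed

lemma excursion_moment_0_le:
  assumes g: "g \<le> 4" and S: "0 \<le> S"
  shows "excursion_moment j S g 0 \<le> ennreal (8 * ((1 + S)^4 + C))"
proof -
  have "excursion_moment j S g 0 \<le> (\<integral>\<^sup>+\<omega>. ennreal (8 * (1 + S)^4) + ennreal (8 * D j \<omega> ^ 4) \<partial>M)"
    unfolding excursion_moment_def
  proof (intro nn_integral_mono)
    fix \<omega>
    show "(if excursion j S (Suc 0) \<omega> then ennreal (Z (j + Suc 0) \<omega> ^ g) else 0)
        \<le> ennreal (8 * (1 + S)^4) + ennreal (8 * D j \<omega> ^ 4)"
    proof (cases "excursion j S (Suc 0) \<omega>")
      case True
      hence "Z (Suc j) \<omega> \<le> (1 + S) + D j \<omega>"
        using Z_Suc_le[of j \<omega>] r_nonneg Z_nonneg[of j \<omega>] by (auto simp: excursion_def)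
      hence "Z (Suc j) \<omega> ^ g \<le> ((1 + S) + D j \<omega>) ^ g" using Z_nonneg by (intro power_mono) auto
      also have "\<dots> \<le> ((1 + S) + D j \<omega>) ^ 4"
        using S D_nonneg[of j \<omega>] g by (intro power_increasing) auto
      also have "\<dots> \<le> 8 * (1 + S)^4 + 8 * D j \<omega> ^ 4" using power4_add_le by simp
      finally show ?thesis using True S D_nonneg[of j \<omega>]
        by (simp add: ennreal_plus[symmetric] ennreal_leI del: ennreal_plus)
    qed simp
  qed
  also have "\<dots> = ennreal (8 * (1 + S)^4) + 8 * (\<integral>\<^sup>+\<omega>. ennreal (D j \<omega> ^ 4) \<partial>M)"
    using D_nonneg by (subst nn_integral_add) (auto simp: emeasure_space_1 ennreal_mult nn_integral_cmult)
  also have "\<dots> \<le> ennreal (8 * (1 + S)^4) + 8 * ennreal C"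
    using D_fourth_moment by (intro add_left_mono mult_left_mono) auto
  also have "\<dots> = ennreal (8 * (1 + S)^4) + ennreal (8 * C)"
    using C_nonneg by (simp add: ennreal_mult)
  also have "\<dots> = ennreal (8 * ((1 + S)^4 + C))"
    using S C_nonneg by (subst ennreal_plus[symmetric]) (auto simp: distrib_left)
  finally show ?thesis .
qed

definition weighted_excursion_moment :: "nat \<Rightarrow> real \<Rightarrow> nat \<Rightarrow> nat \<Rightarrow> nat \<Rightarrow> ennreal" where
  "weighted_excursion_moment j S \<beta> g N = (\<Sum>L<N. of_nat ((L + 1)^\<beta>) * excursion_moment j S g L)"

lemma weighted_excursion_moment_le:
  assumes g: "g \<le> 3" and weight: "\<And>L::nat. (L + 2)^\<beta> \<le> (L + 1)^\<beta> + c * (L + 1)^(\<beta> - 1)"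
  shows "weighted_excursion_moment j S \<beta> g N
    \<le> excursion_moment j S (Suc g) 0 + of_nat c * weighted_excursion_moment j S (\<beta> - 1) (Suc g) N"
proof -
  let ?u = "\<lambda>L. (of_nat ((L + 1)^\<beta>) :: ennreal)"
  let ?v = "\<lambda>L. (of_nat (c * (L + 1)^(\<beta> - 1)) :: ennreal)"
  have "?u (Suc L) \<le> ?u L + ?v L" for L
  proof -
    have "(Suc L + 1)^\<beta> \<le> (L + 1)^\<beta> + c * (L + 1)^(\<beta> - 1)" using weight[of L] by simp
    hence "(of_nat ((Suc L + 1)^\<beta>) :: ennreal) \<le> of_nat ((L + 1)^\<beta> + c * (L + 1)^(\<beta> - 1))"
      by (rule of_nat_mono)
    thus ?thesis by (simp only: of_nat_add)
  qed
  with excursion_moment_drift[OF g]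
  have summation: "?u N * excursion_moment j S (Suc g) N + (\<Sum>L<N. ?u (Suc L) * excursion_moment j S g L)
      \<le> ?u 0 * excursion_moment j S (Suc g) 0 + (\<Sum>L<N. ?v L * excursion_moment j S (Suc g) L)"
    by (rule weighted_drift_summation)
  have "weighted_excursion_moment j S \<beta> g N \<le> (\<Sum>L<N. ?u (Suc L) * excursion_moment j S g L)"
    unfolding weighted_excursion_moment_def
    by (intro sum_mono mult_right_mono of_nat_mono power_mono) auto
  also have "\<dots> \<le> ?u N * excursion_moment j S (Suc g) N + (\<Sum>L<N. ?u (Suc L) * excursion_moment j S g L)"
    by simp
  also note summation
  also have "?u 0 * excursion_moment j S (Suc g) 0 + (\<Sum>L<N. ?v L * excursion_moment j S (Suc g) L)
      = excursion_moment j S (Suc g) 0 + of_nat c * weighted_excursion_moment j S (\<beta> - 1) (Suc g) N"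
    unfolding weighted_excursion_moment_def by (simp add: sum_distrib_left mult.assoc)
  finally show ?thesis .
qed

lemma excursion_moment_4_le: "excursion_moment j S 4 L \<le> excursion_moment j S 4 0"
proof (induction L)
  case (Suc L)
  have "excursion_moment j S 4 (Suc L) + excursion_moment j S 3 L \<le> excursion_moment j S 4 L"
    using excursion_moment_drift[of 3] by (simp add: eval_nat_numeral)
  hence "excursion_moment j S 4 (Suc L) \<le> excursion_moment j S 4 L"
    by (rule order_trans[OF add_increasing2[OF zero_le order_refl]])
  thus ?case using Suc.IH by (rule order_trans)
qed simp

lemma excursion_Suc_imp: "excursion j S (Suc L) \<omega> \<Longrightarrow> excursion j S L \<omega>"
  unfolding excursion_def by simp

lemma excursion_moment_0_antimono: "excursion_moment j S 0 (Suc L) \<le> excursion_moment j S 0 L"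
  unfolding excursion_moment_def by (intro nn_integral_mono) (simp add: excursion_Suc_imp)

lemma ennreal_add_of_nat_mult: "(x::ennreal) + of_nat a * x = of_nat (Suc a) * x"
  by (simp add: distrib_right)

text \<open>Iterates the drift inequality from \<open>g = 3\<close> down to \<open>g = 0\<close>, lowering the degree of the
  weights by one at each stage.\<close>
lemma weighted_excursion_moment_3_0_le:
  assumes S: "0 \<le> S"
  shows "weighted_excursion_moment j S 3 0 N \<le> 50 * ennreal (8 * ((1 + S)^4 + C))"
proof -
  define B where "B = ennreal (8 * ((1 + S)^4 + C))"
  have start: "g \<le> 4 \<Longrightarrow> excursion_moment j S g 0 \<le> B" for g
    unfolding B_def using S excursion_moment_0_le by blast
  have "weighted_excursion_moment j S 0 3 N
      \<le> excursion_moment j S (Suc 3) 0 + of_nat 0 * weighted_excursion_moment j S (0 - 1) (Suc 3) N"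
    by (rule weighted_excursion_moment_le) auto
  hence W03: "weighted_excursion_moment j S 0 3 N \<le> B"
    using start[of 4] by (simp add: eval_nat_numeral)
  have "weighted_excursion_moment j S 1 2 N
      \<le> excursion_moment j S (Suc 2) 0 + of_nat 1 * weighted_excursion_moment j S (1 - 1) (Suc 2) N"
    by (rule weighted_excursion_moment_le) auto
  also have "\<dots> \<le> B + B" using start[of 3] W03 by (intro add_mono) (auto simp: eval_nat_numeral)
  finally have W12: "weighted_excursion_moment j S 1 2 N \<le> 2 * B" by (simp add: mult_2)
  have "weighted_excursion_moment j S 2 1 N
      \<le> excursion_moment j S (Suc 1) 0 + of_nat 3 * weighted_excursion_moment j S (2 - 1) (Suc 1) N"
    by (rule weighted_excursion_moment_le) (auto simp: power2_eq_square algebra_simps)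
  also have "\<dots> \<le> B + of_nat 3 * (2 * B)" using start[of 2] W12
    by (intro add_mono mult_left_mono) (auto simp: eval_nat_numeral)
  also have "\<dots> = 7 * B"
    using ennreal_add_of_nat_mult[of B 6] by (simp add: mult.assoc[symmetric] eval_nat_numeral)
  finally have W21: "weighted_excursion_moment j S 2 1 N \<le> 7 * B" .
  have "weighted_excursion_moment j S 3 0 N
      \<le> excursion_moment j S (Suc 0) 0 + of_nat 7 * weighted_excursion_moment j S (3 - 1) (Suc 0) N"
    by (rule weighted_excursion_moment_le) (auto simp: power2_eq_square power3_eq_cube algebra_simps)
  also have "\<dots> \<le> B + of_nat 7 * (7 * B)" using start[of 1] W21
    by (intro add_mono mult_left_mono) (auto simp: eval_nat_numeral)
  also have "\<dots> = 50 * B"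
    using ennreal_add_of_nat_mult[of B 49] by (simp add: mult.assoc[symmetric] eval_nat_numeral)
  finally show ?thesis unfolding B_def .
qed

lemma excursion_probability_le:
  assumes S: "0 \<le> S"
  shows "of_nat ((L + 1)^4) * excursion_moment j S 0 L \<le> 200 * ennreal (8 * ((1 + S)^4 + C))"
proof -
  have "(L + 1)^4 = (Suc L)^2 * (Suc L)^2" by (simp flip: power_add)
  also have "\<dots> \<le> (Suc L)^2 * (Suc L + 1)^2" by (intro mult_left_mono power_mono) auto
  also have "\<dots> = 4 * (\<Sum>l<Suc L. (l + 1)^3)" using sum_of_cubes[of "Suc L"] by simp
  finally have "(of_nat ((L + 1)^4) :: ennreal) \<le> 4 * (\<Sum>l<Suc L. of_nat ((l + 1)^3))"
    by (metis of_nat_mono of_nat_sum of_nat_mult of_nat_numeral)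
  hence "of_nat ((L + 1)^4) * excursion_moment j S 0 L
      \<le> (4 * (\<Sum>l<Suc L. of_nat ((l + 1)^3))) * excursion_moment j S 0 L"
    by (rule mult_right_mono) simp
  also have "\<dots> = 4 * ((\<Sum>l<Suc L. of_nat ((l + 1)^3)) * excursion_moment j S 0 L)"
    by (rule mult.assoc)
  also have "\<dots> \<le> 4 * weighted_excursion_moment j S 3 0 (Suc L)"
    unfolding weighted_excursion_moment_def sum_distrib_right
    using decseqD[OF decseq_SucI[of "excursion_moment j S 0", OF excursion_moment_0_antimono]]
    by (intro mult_left_mono sum_mono) auto
  also have "4 * weighted_excursion_moment j S 3 0 (Suc L) \<le> 4 * (50 * ennreal (8 * ((1 + S)^4 + C)))"
    using weighted_excursion_moment_3_0_le[OF S] by (rule mult_left_mono) simp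
  finally show ?thesis by (simp add: mult.assoc[symmetric])
qed

lemma excursion_moment_2_le:
  assumes S: "0 \<le> S"
  shows "of_nat ((L + 1)^2) * excursion_moment j S 2 L \<le> 201 * ennreal (8 * ((1 + S)^4 + C))"
proof -
  define B where "B = ennreal (8 * ((1 + S)^4 + C))"
  define m :: nat where "m = (L + 1)^2"
  have "of_nat m * excursion_moment j S 2 L
      = (\<integral>\<^sup>+\<omega>. of_nat m * (if excursion j S (Suc L) \<omega> then ennreal (Z (j + Suc L) \<omega> ^ 2) else 0) \<partial>M)"
    unfolding excursion_moment_def by (rule nn_integral_cmult[symmetric]) measurable
  also have "\<dots> \<le> (\<integral>\<^sup>+\<omega>. (if excursion j S (Suc L) \<omega> then ennreal (Z (j + Suc L) \<omega> ^ 4) else 0)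
       + of_nat (m^2) * (if excursion j S (Suc L) \<omega> then ennreal (Z (j + Suc L) \<omega> ^ 0) else 0) \<partial>M)"
  proof (intro nn_integral_mono)
    fix \<omega>
    define z where "z = Z (j + Suc L) \<omega>"
    have "0 \<le> (z^2 - real m)^2" "0 \<le> real m * z^2" by simp_all
    hence "real m * z^2 \<le> z^4 + (real m)^2"
      by (simp add: power2_eq_square power4_eq_xxxx algebra_simps)
    hence "ennreal (real m * z^2) \<le> ennreal (z^4 + real (m^2))"
      by (intro ennreal_leI) simp
    moreover have "of_nat (m^2) = ennreal (real (m^2))"
      by (rule ennreal_of_nat_eq_real_of_nat)
    ultimately have "of_nat m * ennreal (z^2) \<le> ennreal (z^4) + of_nat (m^2)"
      by (simp add: ennreal_of_nat_eq_real_of_nat ennreal_mult ennreal_plus del: of_nat_power)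
    thus "of_nat m * (if excursion j S (Suc L) \<omega> then ennreal (Z (j + Suc L) \<omega> ^ 2) else 0)
       \<le> (if excursion j S (Suc L) \<omega> then ennreal (Z (j + Suc L) \<omega> ^ 4) else 0)
       + of_nat (m^2) * (if excursion j S (Suc L) \<omega> then ennreal (Z (j + Suc L) \<omega> ^ 0) else 0)"
      unfolding z_def by auto
  qed
  also have "\<dots> = excursion_moment j S 4 L + of_nat (m^2) * excursion_moment j S 0 L"
    unfolding excursion_moment_def by (subst nn_integral_add) (auto simp: nn_integral_cmult)
  also have "\<dots> \<le> B + 200 * B"
  proof (intro add_mono)
    show "excursion_moment j S 4 L \<le> B"
      using excursion_moment_4_le[of j S L] excursion_moment_0_le[of 4 S j] S unfolding B_def by simp
    have "m^2 = (L + 1)^4" unfolding m_def by (simp flip: power_mult)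
    thus "of_nat (m^2) * excursion_moment j S 0 L \<le> 200 * B"
      using excursion_probability_le[OF S, of L j] unfolding B_def by simp
  qed
  also have "\<dots> = 201 * B" using ennreal_add_of_nat_mult[of B 200] by (simp add: eval_nat_numeral)
  finally show ?thesis unfolding m_def B_def by simp
qed

lemma exists_excursion:
  assumes "r < Z (Suc m) \<omega>"
  shows "\<exists>j<Suc m. excursion j (max r z0) (Suc m - j) \<omega>"
  using assms
proof (induction m)
  case 0
  hence "excursion 0 (max r z0) 1 \<omega>" using Z_0 unfolding excursion_def by (auto simp: le_Suc_eq)
  thus ?case by auto
next
  case (Suc m)
  show ?case
  proof (cases "Z (Suc m) \<omega> \<le> r")
    case True
    with Suc.prems have "excursion (Suc m) (max r z0) 1 \<omega>"
      unfolding excursion_def by (auto simp: le_Suc_eq)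
    thus ?thesis by (intro exI[of _ "Suc m"]) auto
  next
    case False
    then obtain j where j: "j < Suc m" "excursion j (max r z0) (Suc m - j) \<omega>"
      using Suc.IH by auto
    with Suc.prems have "excursion j (max r z0) (Suc (Suc m) - j) \<omega>"
      unfolding excursion_def by (auto simp: le_Suc_eq Suc_diff_le)
    thus ?thesis using j by (intro exI[of _ j]) auto
  qed
qed

lemma Z_square_le_excursions:
  "ennreal (Z n \<omega> ^ 2) \<le> ennreal ((max r z0)^2) + (\<Sum>j<n. (if excursion j (max r z0) (Suc (n - Suc j)) \<omega>
      then ennreal (Z (j + Suc (n - Suc j)) \<omega> ^ 2) else 0))"
proof (cases "r < Z n \<omega> \<and> n \<noteq> 0")
  case True
  then obtain m where "n = Suc m" by (cases n) auto
  then obtain j where j: "j < n" "excursion j (max r z0) (n - j) \<omega>"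
    using exists_excursion[of m \<omega>] True by auto
  hence "Suc (n - Suc j) = n - j" "j + Suc (n - Suc j) = n" by auto
  with j have "ennreal (Z n \<omega> ^ 2) = (if excursion j (max r z0) (Suc (n - Suc j)) \<omega>
      then ennreal (Z (j + Suc (n - Suc j)) \<omega> ^ 2) else 0)"
    by simp
  also have "\<dots> \<le> (\<Sum>j<n. (if excursion j (max r z0) (Suc (n - Suc j)) \<omega>
      then ennreal (Z (j + Suc (n - Suc j)) \<omega> ^ 2) else 0))"
    using j by (intro member_le_sum) auto
  finally show ?thesis by (simp add: add_increasing)
next
  case False
  hence "Z n \<omega> \<le> max r z0" using Z_0 by (cases n) auto
  hence "Z n \<omega> ^ 2 \<le> (max r z0)^2" using Z_nonneg[of n \<omega>] by (intro power_mono) auto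
  thus ?thesis by (simp add: add_increasing2 ennreal_leI)
qed

lemma bounded_second_moments: "\<exists>K. \<forall>n. (\<integral>\<^sup>+\<omega>. ennreal (Z n \<omega> ^ 2) \<partial>M) \<le> ennreal K"
proof -
  define S where "S = max r z0"
  have S: "0 \<le> S" using r_nonneg by (simp add: S_def)
  define K where "K = 201 * (8 * ((1 + S)^4 + C))"
  have K: "0 \<le> K" using S C_nonneg unfolding K_def by simp
  have "excursion_moment j S 2 L \<le> ennreal K * ennreal (1 / real ((L + 1)^2))" for j L
    using excursion_moment_2_le[OF S, of L j] S C_nonneg
    by (intro ennreal_le_mult_inverse) (simp_all add: K_def ennreal_mult)
  hence moment_le: "excursion_moment j S 2 L \<le> ennreal K * ennreal (1 / (real L + 1)^2)" for j L
    by (simp add: add.commute)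
  have "(\<integral>\<^sup>+\<omega>. ennreal (Z n \<omega> ^ 2) \<partial>M) \<le> ennreal (S^2 + 2 * K)" for n
  proof -
    have "(\<integral>\<^sup>+\<omega>. ennreal (Z n \<omega> ^ 2) \<partial>M)
      \<le> (\<integral>\<^sup>+\<omega>. ennreal (S^2) + (\<Sum>j<n. (if excursion j S (Suc (n - Suc j)) \<omega>
          then ennreal (Z (j + Suc (n - Suc j)) \<omega> ^ 2) else 0)) \<partial>M)"
      unfolding S_def by (intro nn_integral_mono Z_square_le_excursions)
    also have "\<dots> = ennreal (S^2) + (\<Sum>j<n. excursion_moment j S 2 (n - Suc j))"
      unfolding excursion_moment_def
      by (subst nn_integral_add) (auto simp: nn_integral_sum emeasure_space_1)
    also have "\<dots> \<le> ennreal (S^2) + (\<Sum>j<n. ennreal K * ennreal (1 / (real (n - Suc j) + 1)^2))"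
      by (intro add_left_mono sum_mono moment_le)
    also have "\<dots> \<le> ennreal (S^2) + ennreal (2 * K)"
    proof (rule add_left_mono)
      have "0 \<le> 2 / (real n + 1)" by simp
      hence "(\<Sum>L<n. 1 / (real L + 1)^2) \<le> 2" using sum_inverse_squares_le[of n] by linarith
      hence "ennreal K * ennreal (\<Sum>L<n. 1 / (real L + 1)^2) \<le> ennreal K * ennreal 2"
        by (intro mult_left_mono ennreal_leI) auto
      hence "ennreal K * ennreal (\<Sum>L<n. 1 / (real L + 1)^2) \<le> ennreal (2 * K)"
        using K by (simp add: ennreal_mult'' mult.commute)
      thus "(\<Sum>j<n. ennreal K * ennreal (1 / (real (n - Suc j) + 1)^2)) \<le> ennreal (2 * K)"
        by (subst sum.nat_diff_reindex[of "\<lambda>L. ennreal K * ennreal (1 / (real L + 1)^2)" n])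
           (simp add: sum_distrib_left[symmetric])
    qed
    also have "\<dots> = ennreal (S^2 + 2 * K)"
      using K by (simp add: ennreal_plus)
    finally show ?thesis .
  qed
  thus ?thesis by blast
qed

end

section \<open>A bounded block controller\<close>

lemma norm_orthogonal_matrix_vector_mul:
  "orthogonal_matrix Q \<Longrightarrow> norm (Q *v v) = norm (v :: real^'n)"
  using orthogonal_transformation_matrix[of "\<lambda>x. Q *v x"]
  by (simp add: orthogonal_transformation_norm)

lemma orthogonal_matrix_matpow: "orthogonal_matrix A \<Longrightarrow> orthogonal_matrix (matpow A n)"
  by (induction n) (auto intro: orthogonal_matrix_mul orthogonal_matrix_id)

lemma matrix_vector_mult_borel_measurable[measurable]:
  "(\<lambda>x. (Q :: real^'n^'m) *v x) \<in> borel_measurable borel"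
  by (intro borel_measurable_continuous_onI matrix_vector_mult_linear_continuous_on)

lemma reachable_in_basis_controls:
  fixes A :: "real^'d^'d" and B :: "real^'m^'d"
  assumes "reachable_in A B k"
  shows "\<exists>c. \<forall>j::'d. (\<Sum>i<k. (matpow A i ** B) *v c j i) = axis j 1"
proof -
  let ?S = "\<Union>i<k. columns (matpow A i ** B)"
  let ?R = "{v. \<exists>u. v = (\<Sum>i<k. (matpow A i ** B) *v u i)}"
  have "dim ?S = DIM(real^'d)" using assms unfolding reachable_in_def reach_rank_def by simp
  hence "vec.span ?S = vec.span UNIV" by (intro vec.dim_eq_span) (auto simp: dim_vec_eq vec_dim_card)
  hence "vec.span ?S = UNIV" by (simp only: vec.span_UNIV)
  hence span_UNIV: "span ?S = UNIV" by (simp only: span_vec_eq)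
  have "subspace ?R"
    unfolding subspace_def
  proof (intro conjI ballI allI)
    show "0 \<in> ?R" by (intro CollectI exI[of _ "\<lambda>_. 0"]) simp
    fix x y assume "x \<in> ?R" "y \<in> ?R"
    then obtain u u' where "x = (\<Sum>i<k. (matpow A i ** B) *v u i)" "y = (\<Sum>i<k. (matpow A i ** B) *v u' i)"
      by auto
    thus "x + y \<in> ?R"
      by (intro CollectI exI[of _ "\<lambda>i. u i + u' i"]) (simp add: matrix_vector_right_distrib sum.distrib)
  next
    fix c :: real and x assume "x \<in> ?R"
    then obtain u where "x = (\<Sum>i<k. (matpow A i ** B) *v u i)" by auto
    thus "c *\<^sub>R x \<in> ?R"
      by (intro CollectI exI[of _ "\<lambda>i. c *\<^sub>R u i"]) (simp add: scaleR_sum_right matrix_vector_mult_scaleR)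
  qed
  moreover have "?S \<subseteq> ?R"
  proof
    fix v assume "v \<in> ?S"
    then obtain i0 j where i0: "i0 < k" and "v = column j (matpow A i0 ** B)"
      unfolding columns_def by auto
    hence "v = (matpow A i0 ** B) *v axis j 1" by (simp add: matrix_vector_mult_basis)
    also have "\<dots> = (\<Sum>i<k. (matpow A i ** B) *v (if i = i0 then axis j 1 else 0))"
      using i0 by (simp add: if_distrib[of "\<lambda>u. _ *v u"] sum.delta cong: if_cong)
    finally show "v \<in> ?R" by (intro CollectI exI[where x = "\<lambda>i. if i = i0 then axis j 1 else 0"])
  qed
  ultimately have "span ?S \<subseteq> ?R" by (rule span_minimal[rotated])
  hence "\<forall>j::'d. \<exists>u. axis j 1 = (\<Sum>i<k. (matpow A i ** B) *v u i)" using span_UNIV by auto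
  thus ?thesis by metis
qed

lemma reachable_in_right_inverse:
  fixes A :: "real^'d^'d" and B :: "real^'m^'d"
  assumes "reachable_in A B k"
  shows "\<exists>K :: nat \<Rightarrow> real^'d^'m. \<forall>v. (\<Sum>i<k. matpow A i *v (B *v (K i *v v))) = v"
proof -
  obtain c :: "'d \<Rightarrow> nat \<Rightarrow> real^'m" where c: "\<And>j. (\<Sum>i<k. (matpow A i ** B) *v c j i) = axis j 1"
    using reachable_in_basis_controls[OF assms] by blast
  define K where "K i = (\<chi> a b. c b i $ a)" for i
  have K: "K i *v v = (\<Sum>j\<in>UNIV. (v $ j) *\<^sub>R c j i)" for i v
    by (simp add: K_def vec_eq_iff matrix_vector_mult_def mult.commute)
  have "(\<Sum>i<k. matpow A i *v (B *v (K i *v v))) = v" for v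
  proof -
    have "(\<Sum>i<k. matpow A i *v (B *v (K i *v v)))
        = (\<Sum>i<k. \<Sum>j\<in>UNIV. (v $ j) *\<^sub>R ((matpow A i ** B) *v c j i))"
      by (simp add: K matrix_vector_mul_assoc linear_sum[OF matrix_vector_mul_linear]
          matrix_vector_mult_scaleR)
    also have "\<dots> = (\<Sum>j\<in>UNIV. (v $ j) *\<^sub>R (\<Sum>i<k. (matpow A i ** B) *v c j i))"
      by (subst sum.swap) (simp add: scaleR_sum_right)
    also have "\<dots> = v" by (simp add: c scalar_mult_eq_scaleR[symmetric] basis_expansion)
    finally show ?thesis .
  qed
  thus ?thesis by blast
qed

lemma norm_sub_truncate:
  fixes y :: "'a::real_normed_vector"
  assumes "0 \<le> r"
  shows "norm (y - min 1 (r / norm y) *\<^sub>R y) = max (norm y - r) 0"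
proof (cases "norm y \<le> r")
  case True
  thus ?thesis by (cases "y = 0") auto
next
  case False
  hence y: "0 < norm y" using assms by linarith
  with False have le1: "r / norm y \<le> 1" by (simp add: divide_le_eq_1)
  hence "y - min 1 (r / norm y) *\<^sub>R y = (1 - r / norm y) *\<^sub>R y" by (simp add: algebra_simps)
  also have "norm \<dots> = (1 - r / norm y) * norm y" using le1 by simp
  also have "\<dots> = norm y - r" using y by (simp add: algebra_simps)
  finally show ?thesis using False by simp
qed

lemma norm_truncate_le:
  fixes y :: "'a::real_normed_vector"
  assumes "0 \<le> r"
  shows "norm (min 1 (r / norm y) *\<^sub>R y) \<le> r"
proof (cases "y = 0")
  case False
  hence "min 1 (r / norm y) * norm y \<le> r / norm y * norm y"
    by (intro mult_right_mono) auto
  thus ?thesis using assms False by simp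
qed (use assms in simp)

lemma block_controller_exists:
  fixes A :: "real^'d^'d" and B :: "real^'m^'d"
  assumes orth: "orthogonal_matrix A" and reach: "reachable_in A B k" and r: "0 \<le> r"
  shows "\<exists>f :: nat \<Rightarrow> real^'d \<Rightarrow> real^'m. \<exists>\<rho>>0.
     (\<forall>i. f i \<in> borel_measurable borel) \<and> (\<forall>i<k. \<forall>x. norm (f i x) \<le> \<rho>) \<and>
     (\<forall>x. norm (matpow A k *v x + (\<Sum>i<k. matpow A (k - 1 - i) *v (B *v f i x))) \<le> max (norm x - r) 0)"
proof -
  obtain K :: "nat \<Rightarrow> real^'d^'m" where K: "\<And>v. (\<Sum>i<k. matpow A i *v (B *v (K i *v v))) = v"
    using reachable_in_right_inverse[OF reach] by blast
  define u where "u x = - (min 1 (r / norm (matpow A k *v x)) *\<^sub>R (matpow A k *v x))" for x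
  define f where "f i x = K (k - 1 - i) *v u x" for i x
  define \<rho> where "\<rho> = r * (\<Sum>i<k. onorm ((*v) (K i))) + 1"
  have onorm_nonneg: "0 \<le> onorm ((*v) (K i))" for i
    by (rule onorm_pos_le[OF matrix_vector_mul_bounded_linear])
  have control_sum: "(\<Sum>i<k. matpow A (k - 1 - i) *v (B *v f i x)) = u x" for x
    unfolding f_def using K[of "u x"] sum.nat_diff_reindex[of "\<lambda>i. matpow A i *v (B *v (K i *v u x))" k]
    by (simp add: diff_Suc_eq_diff_pred[symmetric])
  have contraction: "norm (matpow A k *v x + u x) = max (norm x - r) 0" for x
    using norm_sub_truncate[OF r, of "matpow A k *v x"]
    by (simp add: u_def norm_orthogonal_matrix_vector_mul[OF orthogonal_matrix_matpow[OF orth]])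
  have bounded: "norm (f i x) \<le> \<rho>" if "i < k" for i x
  proof -
    have "norm (f i x) \<le> onorm ((*v) (K (k - 1 - i))) * norm (u x)"
      unfolding f_def by (rule onorm[OF matrix_vector_mul_bounded_linear])
    also have "\<dots> \<le> onorm ((*v) (K (k - 1 - i))) * r"
      using norm_truncate_le[OF r] onorm_nonneg by (intro mult_left_mono) (auto simp: u_def)
    also have "\<dots> \<le> (\<Sum>i<k. onorm ((*v) (K i))) * r"
      using that r onorm_nonneg by (intro mult_right_mono member_le_sum) auto
    finally show ?thesis unfolding \<rho>_def by (simp add: mult.commute)
  qed
  have measurable: "f i \<in> borel_measurable borel" for i
    unfolding f_def u_def by measurable
  have "0 < \<rho>"
    unfolding \<rho>_def using r onorm_nonneg by (intro add_nonneg_pos mult_nonneg_nonneg sum_nonneg) auto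
  moreover have "norm (matpow A k *v x + (\<Sum>i<k. matpow A (k - 1 - i) *v (B *v f i x)))
      \<le> max (norm x - r) 0" for x
    by (simp only: control_sum contraction order_refl)
  ultimately show ?thesis using measurable bounded by (intro exI[of _ f] exI[of _ \<rho>]) auto
qed

section \<open>The closed-loop system\<close>

lemma matpow_sum_Suc:
  fixes A :: "real^'d^'d" and y :: "nat \<Rightarrow> real^'d"
  shows "A *v (\<Sum>i<s. matpow A (s - 1 - i) *v y i) + y s = (\<Sum>i<Suc s. matpow A (Suc s - 1 - i) *v y i)"
proof -
  have "A *v (\<Sum>i<s. matpow A (s - 1 - i) *v y i) = (\<Sum>i<s. A *v (matpow A (s - 1 - i) *v y i))"
    by (rule linear_sum[OF matrix_vector_mul_linear])
  also have "\<dots> = (\<Sum>i<s. matpow A (Suc s - 1 - i) *v y i)"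
  proof (intro sum.cong refl)
    fix i assume "i \<in> {..<s}"
    hence "Suc s - 1 - i = Suc (s - 1 - i)" by auto
    thus "A *v (matpow A (s - 1 - i) *v y i) = matpow A (Suc s - 1 - i) *v y i"
      by (simp add: matrix_vector_mul_assoc)
  qed
  finally show ?thesis by simp
qed

lemma closed_loop_block:
  assumes "s \<le> k"
  shows "closed_loop A B k f w x (n * k + s) \<omega> =
     matpow A s *v closed_loop A B k f w x (n * k) \<omega>
     + (\<Sum>i<s. matpow A (s - 1 - i) *v (B *v f i (closed_loop A B k f w x (n * k) \<omega>)))
     + (\<Sum>i<s. matpow A (s - 1 - i) *v w (n * k + i) \<omega>)"
  using assms
proof (induction s)
  case 0
  thus ?case by (simp add: matrix_vector_mul_lid)
next
  case (Suc s)
  let ?X = "closed_loop A B k f w x (n * k) \<omega>"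
  have "(n * k + s) mod k = s" "(n * k + s) div k = n" using Suc.prems by auto
  hence "closed_loop A B k f w x (n * k + Suc s) \<omega>
      = A *v closed_loop A B k f w x (n * k + s) \<omega> + B *v f s ?X + w (n * k + s) \<omega>"
    by simp
  also have "\<dots> = matpow A (Suc s) *v ?X
     + (A *v (\<Sum>i<s. matpow A (s - 1 - i) *v (B *v f i ?X)) + B *v f s ?X)
     + (A *v (\<Sum>i<s. matpow A (s - 1 - i) *v w (n * k + i) \<omega>) + w (n * k + s) \<omega>)"
    using Suc by (simp add: matrix_vector_right_distrib matrix_vector_mul_assoc algebra_simps)
  also have "\<dots> = matpow A (Suc s) *v ?X
     + (\<Sum>i<Suc s. matpow A (Suc s - 1 - i) *v (B *v f i ?X))
     + (\<Sum>i<Suc s. matpow A (Suc s - 1 - i) *v w (n * k + i) \<omega>)"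
    by (simp only: matpow_sum_Suc[of A s "\<lambda>i. B *v f i ?X"] matpow_sum_Suc[of A s "\<lambda>i. w (n * k + i) \<omega>"])
  finally show ?case .
qed

lemma closed_loop_cong:
  assumes "\<And>i. i < t \<Longrightarrow> w i \<omega> = w' i \<omega>'"
  shows "closed_loop A B k f w x t \<omega> = closed_loop A B k f w' x t \<omega>'"
  using assms
proof (induction t rule: less_induct)
  case (less t)
  show ?case
  proof (cases t)
    case (Suc s)
    have le: "s div k * k \<le> s" by (simp add: div_times_less_eq_dividend)
    have "closed_loop A B k f w x s \<omega> = closed_loop A B k f w' x s \<omega>'"
      "closed_loop A B k f w x (s div k * k) \<omega> = closed_loop A B k f w' x (s div k * k) \<omega>'"
      using less.IH[of s] less.IH[of "s div k * k"] less.prems le Suc by auto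
    with less.prems Suc show ?thesis by simp
  qed simp
qed

lemma closed_loop_measurable_PiM:
  assumes f: "\<And>i. f i \<in> borel_measurable borel" and "{..<t} \<subseteq> I"
  shows "(\<lambda>p. closed_loop A B k f (\<lambda>i p. p i) x t p) \<in> borel_measurable (PiM I (\<lambda>_. borel))"
  using assms(2)
proof (induction t rule: less_induct)
  case (less t)
  show ?case
  proof (cases t)
    case (Suc s)
    have lt: "s < t" "s div k * k < t"
      using Suc by (auto simp: le_imp_less_Suc div_times_less_eq_dividend)
    hence "{..<s} \<subseteq> I" "{..<s div k * k} \<subseteq> I"
      using less.prems by (meson lessThan_subset_iff less_imp_le order_trans)+
    with lt have [measurable]:
      "(\<lambda>p. closed_loop A B k f (\<lambda>i p. p i) x s p) \<in> borel_measurable (PiM I (\<lambda>_. borel))"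
      "(\<lambda>p. closed_loop A B k f (\<lambda>i p. p i) x (s div k * k) p) \<in> borel_measurable (PiM I (\<lambda>_. borel))"
      by (simp_all add: less.IH)
    have [measurable]: "(\<lambda>p::nat \<Rightarrow> real^'a. p s) \<in> borel_measurable (PiM I (\<lambda>_. borel))"
      using less.prems Suc by auto
    have [measurable]: "f (s mod k) \<in> borel_measurable borel" by (rule f)
    show ?thesis unfolding Suc by simp
  qed simp
qed

lemma closed_loop_measurable[measurable]:
  assumes "\<And>i. f i \<in> borel_measurable borel" and "\<And>t. w t \<in> borel_measurable M"
  shows "(\<lambda>\<omega>. closed_loop A B k f w x t \<omega>) \<in> borel_measurable M"
proof -
  have "closed_loop A B k f w x t \<omega> = closed_loop A B k f (\<lambda>i p. p i) x t (restrict (\<lambda>i. w i \<omega>) {..<t})"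
    for \<omega>
    by (rule closed_loop_cong) simp
  moreover have "(\<lambda>\<omega>. restrict (\<lambda>i. w i \<omega>) {..<t}) \<in> measurable M (PiM {..<t} (\<lambda>_. borel))"
    using assms(2) by (intro measurable_restrict) auto
  ultimately show ?thesis
    using measurable_compose[OF _ closed_loop_measurable_PiM[OF assms(1) order_refl]] by simp
qed

definition block_noise :: "nat \<Rightarrow> (nat \<Rightarrow> 'a \<Rightarrow> real^'d) \<Rightarrow> nat \<Rightarrow> 'a \<Rightarrow> real" where
  "block_noise k w n \<omega> = (\<Sum>i<k. norm (w (n * k + i) \<omega>))"

lemma block_noise_nonneg: "0 \<le> block_noise k w n \<omega>"
  unfolding block_noise_def by (simp add: sum_nonneg)

lemma block_noise_measurable[measurable]:
  "(\<And>t. w t \<in> borel_measurable M) \<Longrightarrow> block_noise k w n \<in> borel_measurable M"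
  unfolding block_noise_def by measurable

lemma (in prob_space) block_noise_fourth_moment:
  assumes [measurable]: "\<And>t. w t \<in> borel_measurable M"
    and "\<And>t. (\<integral>\<^sup>+\<omega>. ennreal (norm (w t \<omega>) ^ 4) \<partial>M) \<le> ennreal C4" and "0 \<le> C4"
  shows "(\<integral>\<^sup>+\<omega>. ennreal (block_noise k w n \<omega> ^ 4) \<partial>M) \<le> ennreal (real k ^ 4 * C4)"
proof -
  have "(\<integral>\<^sup>+\<omega>. ennreal (block_noise k w n \<omega> ^ 4) \<partial>M)
      \<le> (\<integral>\<^sup>+\<omega>. (\<Sum>i<k. ennreal (real k ^ 3) * ennreal (norm (w (n * k + i) \<omega>) ^ 4)) \<partial>M)"
  proof (intro nn_integral_mono)
    fix \<omega>
    have "block_noise k w n \<omega> ^ 4 \<le> real k ^ 3 * (\<Sum>i<k. norm (w (n * k + i) \<omega>) ^ 4)"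
      using power4_sum_le[of "\<lambda>i. norm (w (n * k + i) \<omega>)" "{..<k}"] by (simp add: block_noise_def)
    thus "ennreal (block_noise k w n \<omega> ^ 4)
        \<le> (\<Sum>i<k. ennreal (real k ^ 3) * ennreal (norm (w (n * k + i) \<omega>) ^ 4))"
      by (simp add: sum_distrib_left[symmetric] ennreal_mult[symmetric] sum_ennreal ennreal_leI)
  qed
  also have "\<dots> = (\<Sum>i<k. ennreal (real k ^ 3) * (\<integral>\<^sup>+\<omega>. ennreal (norm (w (n * k + i) \<omega>) ^ 4) \<partial>M))"
    by (subst nn_integral_sum) (auto simp: nn_integral_cmult)
  also have "\<dots> \<le> (\<Sum>i<k. ennreal (real k ^ 3) * ennreal C4)"
    by (intro sum_mono mult_left_mono assms(2)) auto
  also have "\<dots> = ennreal (real k ^ 4 * C4)"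
    using assms(3) by (simp add: ennreal_mult[symmetric] ennreal_of_nat_eq_real_of_nat
        power_Suc[symmetric] mult.assoc del: of_nat_power power_Suc)
  finally show ?thesis .
qed

text \<open>The block-boundary states up to time \<open>n k\<close> depend only on the noise before time \<open>n k\<close>.\<close>
lemma (in prob_space) closed_loop_indep_block_noise:
  fixes w :: "nat \<Rightarrow> 'a \<Rightarrow> real^'d"
  assumes indep: "indep_vars (\<lambda>_. borel) w UNIV"
    and f: "\<And>i. f i \<in> borel_measurable borel"
    and F: "F \<in> borel_measurable (PiM UNIV (\<lambda>_. borel) \<Otimes>\<^sub>M borel)"
  shows "(\<integral>\<^sup>+\<omega>. F (\<lambda>i. norm (closed_loop A B k f w x (min i n * k) \<omega>), block_noise k w n \<omega>) \<partial>M)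
    = (\<integral>\<^sup>+\<omega>. \<integral>\<^sup>+\<omega>'. F (\<lambda>i. norm (closed_loop A B k f w x (min i n * k) \<omega>), block_noise k w n \<omega>') \<partial>M \<partial>M)"
proof -
  define past where "past \<omega> = restrict (\<lambda>i. w i \<omega>) {..<n * k}" for \<omega>
  define block where "block \<omega> = restrict (\<lambda>i. w i \<omega>) {n * k..<n * k + k}" for \<omega>
  define H where "H p i = norm (closed_loop A B k f (\<lambda>i p. p i) x (min i n * k) p)" for p i
  define G where "G q = (\<lambda>_::nat. \<Sum>i<k. norm (q (n * k + i) :: real^'d))" for q
  have "indep_var (PiM {..<n * k} (\<lambda>_. borel)) past (PiM {n * k..<n * k + k} (\<lambda>_. borel)) block"
    unfolding past_def block_def by (rule indep_var_restrict[OF indep]) auto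
  moreover have "H \<in> measurable (PiM {..<n * k} (\<lambda>_. borel)) (PiM UNIV (\<lambda>_. borel))"
    unfolding H_def
  proof (rule measurable_PiM_single')
    fix i :: nat
    have "{..<min i n * k} \<subseteq> {..<n * k}" by auto
    from closed_loop_measurable_PiM[OF f this]
    show "(\<lambda>p. norm (closed_loop A B k f (\<lambda>i p. p i) x (min i n * k) p))
        \<in> borel_measurable (PiM {..<n * k} (\<lambda>_. borel))"
      by measurable
  qed auto
  moreover have "G \<in> measurable (PiM {n * k..<n * k + k} (\<lambda>_. borel)) (PiM UNIV (\<lambda>_. borel))"
    unfolding G_def
    by (intro measurable_PiM_single' borel_measurable_sum borel_measurable_norm
        measurable_component_singleton) auto
  ultimately have "indep_var (PiM UNIV (\<lambda>_. borel)) (H \<circ> past) (PiM UNIV (\<lambda>_. borel)) (G \<circ> block)"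
    by (rule indep_var_compose)
  moreover have "(\<lambda>(\<eta>, \<zeta>). F (\<eta>, \<zeta> 0))
      \<in> borel_measurable (PiM UNIV (\<lambda>_. borel) \<Otimes>\<^sub>M PiM UNIV (\<lambda>_. borel))"
    using F by measurable
  ultimately have "(\<integral>\<^sup>+\<omega>. (\<lambda>(\<eta>, \<zeta>). F (\<eta>, \<zeta> 0)) ((H \<circ> past) \<omega>, (G \<circ> block) \<omega>) \<partial>M)
      = (\<integral>\<^sup>+\<omega>. \<integral>\<^sup>+\<omega>'. (\<lambda>(\<eta>, \<zeta>). F (\<eta>, \<zeta> 0)) ((H \<circ> past) \<omega>, (G \<circ> block) \<omega>') \<partial>M \<partial>M)"
    by (rule indep_var_nn_integral)
  moreover have "(H \<circ> past) \<omega> = (\<lambda>i. norm (closed_loop A B k f w x (min i n * k) \<omega>))" for \<omega>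
  proof -
    have "closed_loop A B k f (\<lambda>i p. p i) x (min i n * k) (past \<omega>) = closed_loop A B k f w x (min i n * k) \<omega>"
      for i
      by (rule closed_loop_cong) (use less_le_trans[OF _ mult_right_mono[OF min.cobounded2]] in
          \<open>auto simp: past_def\<close>)
    thus ?thesis unfolding H_def by (simp add: comp_def)
  qed
  moreover have "(G \<circ> block) \<omega> 0 = block_noise k w n \<omega>" for \<omega>
    unfolding G_def block_def block_noise_def by simp
  ultimately show ?thesis by simp
qed

lemma closed_loop_block_contracts:
  fixes A :: "real^'d^'d" and B :: "real^'m^'d"
  assumes orth: "orthogonal_matrix A"
    and contracts: "\<And>x. norm (matpow A k *v x + (\<Sum>i<k. matpow A (k - 1 - i) *v (B *v f i x)))
      \<le> max (norm x - r) 0"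
  shows "norm (closed_loop A B k f w x (Suc n * k) \<omega>)
    \<le> max (norm (closed_loop A B k f w x (n * k) \<omega>) - r) 0 + block_noise k w n \<omega>"
proof -
  let ?X = "closed_loop A B k f w x (n * k) \<omega>"
  have "Suc n * k = n * k + k" by simp
  hence "closed_loop A B k f w x (Suc n * k) \<omega>
      = (matpow A k *v ?X + (\<Sum>i<k. matpow A (k - 1 - i) *v (B *v f i ?X)))
        + (\<Sum>i<k. matpow A (k - 1 - i) *v w (n * k + i) \<omega>)"
    using closed_loop_block[of k k A B f w x n \<omega>] by (simp only: order_refl)
  hence "norm (closed_loop A B k f w x (Suc n * k) \<omega>)
      \<le> max (norm ?X - r) 0 + (\<Sum>i<k. norm (matpow A (k - 1 - i) *v w (n * k + i) \<omega>))"
    by (simp only: norm_triangle_le[OF add_mono[OF contracts norm_sum]])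
  also have "(\<Sum>i<k. norm (matpow A (k - 1 - i) *v w (n * k + i) \<omega>)) = block_noise k w n \<omega>"
    unfolding block_noise_def
    by (simp add: norm_orthogonal_matrix_vector_mul[OF orthogonal_matrix_matpow[OF orth]])
  finally show ?thesis .
qed

lemma closed_loop_norm_le_block:
  fixes A :: "real^'d^'d" and B :: "real^'m^'d"
  assumes orth: "orthogonal_matrix A" and k: "0 < k"
    and bounded: "\<And>i x. i < k \<Longrightarrow> norm (f i x) \<le> \<rho>"
  shows "norm (closed_loop A B k f w x t \<omega>)
    \<le> norm (closed_loop A B k f w x (t div k * k) \<omega>) + real k * (\<rho> * onorm ((*v) B))
      + block_noise k w (t div k) \<omega>"
proof -
  define n s where "n = t div k" and "s = t mod k"
  have s: "s < k" and t: "t = n * k + s" using k by (auto simp: n_def s_def)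
  let ?X = "closed_loop A B k f w x (n * k) \<omega>"
  have orth_pow: "orthogonal_matrix (matpow A j)" for j by (rule orthogonal_matrix_matpow[OF orth])
  have "norm (closed_loop A B k f w x t \<omega>) \<le> norm (matpow A s *v ?X)
      + norm (\<Sum>i<s. matpow A (s - 1 - i) *v (B *v f i ?X))
      + norm (\<Sum>i<s. matpow A (s - 1 - i) *v w (n * k + i) \<omega>)"
    unfolding t closed_loop_block[OF less_imp_le[OF s]]
    by (rule norm_triangle_le[OF add_right_mono[OF norm_triangle_ineq]])
  also have "\<dots> \<le> norm ?X + (\<Sum>i<s. norm (B *v f i ?X)) + (\<Sum>i<s. norm (w (n * k + i) \<omega>))"
    using norm_sum[of "\<lambda>i. matpow A (s - 1 - i) *v (B *v f i ?X)" "{..<s}"]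
      norm_sum[of "\<lambda>i. matpow A (s - 1 - i) *v w (n * k + i) \<omega>" "{..<s}"]
    by (simp add: norm_orthogonal_matrix_vector_mul[OF orth_pow])
  also have "(\<Sum>i<s. norm (B *v f i ?X)) \<le> (\<Sum>i<s. onorm ((*v) B) * \<rho>)"
  proof (intro sum_mono)
    fix i assume "i \<in> {..<s}"
    hence "norm (f i ?X) \<le> \<rho>" using s bounded by simp
    hence "onorm ((*v) B) * norm (f i ?X) \<le> onorm ((*v) B) * \<rho>"
      by (intro mult_left_mono onorm_pos_le[OF matrix_vector_mul_bounded_linear])
    thus "norm (B *v f i ?X) \<le> onorm ((*v) B) * \<rho>"
      using onorm[OF matrix_vector_mul_bounded_linear, of B "f i ?X"] by linarith
  qed
  also have "\<dots> \<le> real k * (\<rho> * onorm ((*v) B))"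
  proof -
    have "0 \<le> \<rho>" using norm_ge_zero[of "f 0 x"] bounded[OF k, of x] by linarith
    hence "0 \<le> onorm ((*v) B) * \<rho>"
      using onorm_pos_le[OF matrix_vector_mul_bounded_linear, of B] by simp
    thus ?thesis using s by (simp add: mult.commute mult_right_mono)
  qed
  also have "(\<Sum>i<s. norm (w (n * k + i) \<omega>)) \<le> block_noise k w n \<omega>"
    unfolding block_noise_def using s by (intro sum_mono2) auto
  finally show ?thesis unfolding n_def by simp
qed

lemma (in prob_space) closed_loop_lindley_drift:
  fixes A :: "real^'d^'d" and B :: "real^'m^'d" and w :: "nat \<Rightarrow> 'a \<Rightarrow> real^'d"
  assumes orth: "orthogonal_matrix A" and indep: "indep_vars (\<lambda>_. borel) w UNIV"
    and C4: "0 \<le> C4" and fourth_moment: "\<And>t. (\<integral>\<^sup>+\<omega>. ennreal (norm (w t \<omega>) ^ 4) \<partial>M) \<le> ennreal C4"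
    and f[measurable]: "\<And>i. f i \<in> borel_measurable borel"
    and contracts: "\<And>x. norm (matpow A k *v x + (\<Sum>i<k. matpow A (k - 1 - i) *v (B *v f i x)))
      \<le> max (norm x - (real k ^ 4 * C4 + 2)) 0"
    and [measurable]: "\<And>t. w t \<in> borel_measurable M"
  shows "lindley_drift M (\<lambda>n \<omega>. norm (closed_loop A B k f w x (n * k) \<omega>)) (block_noise k w)
    (real k ^ 4 * C4 + 2) (norm x) (real k ^ 4 * C4)"
proof (intro lindley_drift.intro lindley_drift_axioms.intro)
  show "(\<integral>\<^sup>+\<omega>. ennreal (block_noise k w n \<omega> ^ 4) \<partial>M) \<le> ennreal (real k ^ 4 * C4)" for n
    by (rule block_noise_fourth_moment[OF _ fourth_moment C4]) simp
  show "norm (closed_loop A B k f w x (Suc n * k) \<omega>)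
      \<le> max (norm (closed_loop A B k f w x (n * k) \<omega>) - (real k ^ 4 * C4 + 2)) 0 + block_noise k w n \<omega>"
    for n \<omega>
    using orth contracts by (rule closed_loop_block_contracts)
  show "(\<integral>\<^sup>+\<omega>. F (\<lambda>i. norm (closed_loop A B k f w x (min i n * k) \<omega>), block_noise k w n \<omega>) \<partial>M)
      = (\<integral>\<^sup>+\<omega>. \<integral>\<^sup>+\<omega>'. F (\<lambda>i. norm (closed_loop A B k f w x (min i n * k) \<omega>),
          block_noise k w n \<omega>') \<partial>M \<partial>M)"
    if "F \<in> borel_measurable (PiM UNIV (\<lambda>_. borel) \<Otimes>\<^sub>M borel)" for n F
    using indep f that by (rule closed_loop_indep_block_noise)
qed (use C4 prob_space_axioms in \<open>auto simp: block_noise_nonneg\<close>)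

lemma closed_loop_second_moment_bounded:
  fixes A :: "real^'d^'d" and B :: "real^'m^'d" and w :: "nat \<Rightarrow> 'a \<Rightarrow> real^'d"
  assumes orth: "orthogonal_matrix A" and k: "0 < k"
    and "prob_space M" and [measurable]: "\<And>t. w t \<in> borel_measurable M"
    and indep: "prob_space.indep_vars M (\<lambda>_. borel) w UNIV"
    and C4: "0 \<le> C4" and fourth_moment: "\<And>t. (\<integral>\<^sup>+\<omega>. ennreal (norm (w t \<omega>) ^ 4) \<partial>M) \<le> ennreal C4"
    and f[measurable]: "\<And>i. f i \<in> borel_measurable borel"
    and bounded: "\<And>i x. i < k \<Longrightarrow> norm (f i x) \<le> \<rho>"
    and contracts: "\<And>x. norm (matpow A k *v x + (\<Sum>i<k. matpow A (k - 1 - i) *v (B *v f i x)))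
      \<le> max (norm x - (real k ^ 4 * C4 + 2)) 0"
  shows "(SUP t. \<integral>\<^sup>+\<omega>. ennreal (norm (closed_loop A B k f w x t \<omega>) ^ 2) \<partial>M) < \<infinity>"
proof -
  interpret prob_space M by fact
  define Z where "Z n \<omega> = norm (closed_loop A B k f w x (n * k) \<omega>)" for n \<omega>
  define C where "C = real k ^ 4 * C4"
  interpret lindley_drift M Z "block_noise k w" "C + 2" "norm x" C
    unfolding Z_def C_def using orth indep C4 fourth_moment f contracts
    by (rule closed_loop_lindley_drift) simp
  obtain K where K: "\<And>n. (\<integral>\<^sup>+\<omega>. ennreal (Z n \<omega> ^ 2) \<partial>M) \<le> ennreal K"
    using bounded_second_moments by blast
  define b where "b = real k * (\<rho> * onorm ((*v) B))"
  have "(\<integral>\<^sup>+\<omega>. ennreal (norm (closed_loop A B k f w x t \<omega>) ^ 2) \<partial>M)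
      \<le> 3 * ennreal K + 3 * ennreal (b^2) + 3 * (1 + ennreal C)" for t
  proof -
    let ?n = "t div k"
    have "ennreal (norm (closed_loop A B k f w x t \<omega>) ^ 2)
        \<le> 3 * ennreal (Z ?n \<omega> ^ 2) + 3 * ennreal (b^2) + 3 * ennreal (block_noise k w ?n \<omega> ^ 2)" for \<omega>
    proof -
      have "norm (closed_loop A B k f w x t \<omega>) \<le> Z ?n \<omega> + b + block_noise k w ?n \<omega>"
        unfolding Z_def b_def using orth k bounded by (rule closed_loop_norm_le_block)
      hence "norm (closed_loop A B k f w x t \<omega>) ^ 2 \<le> (Z ?n \<omega> + b + block_noise k w ?n \<omega>)^2"
        by (intro power_mono) auto
      also have "\<dots> \<le> 3 * Z ?n \<omega> ^ 2 + 3 * b^2 + 3 * block_noise k w ?n \<omega> ^ 2"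
        using power2_sum3_le by simp
      finally have "ennreal (norm (closed_loop A B k f w x t \<omega>) ^ 2)
          \<le> ennreal (3 * Z ?n \<omega> ^ 2 + 3 * b^2 + 3 * block_noise k w ?n \<omega> ^ 2)"
        by (rule ennreal_leI)
      thus ?thesis by (simp add: ennreal_mult)
    qed
    hence "(\<integral>\<^sup>+\<omega>. ennreal (norm (closed_loop A B k f w x t \<omega>) ^ 2) \<partial>M)
        \<le> (\<integral>\<^sup>+\<omega>. 3 * ennreal (Z ?n \<omega> ^ 2) + 3 * ennreal (b^2)
          + 3 * ennreal (block_noise k w ?n \<omega> ^ 2) \<partial>M)"
      by (rule nn_integral_mono)
    also have "\<dots> = 3 * (\<integral>\<^sup>+\<omega>. ennreal (Z ?n \<omega> ^ 2) \<partial>M) + 3 * ennreal (b^2)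
          + 3 * (\<integral>\<^sup>+\<omega>. ennreal (block_noise k w ?n \<omega> ^ 2) \<partial>M)"
      using Z_measurable D_measurable by (simp add: nn_integral_add nn_integral_cmult emeasure_space_1)
    also have "\<dots> \<le> 3 * ennreal K + 3 * ennreal (b^2) + 3 * (1 + ennreal C)"
      using K D_square_moment by (intro add_mono mult_left_mono) auto
    finally show ?thesis .
  qed
  hence "(SUP t. \<integral>\<^sup>+\<omega>. ennreal (norm (closed_loop A B k f w x t \<omega>) ^ 2) \<partial>M)
      \<le> 3 * ennreal K + 3 * ennreal (b^2) + 3 * (1 + ennreal C)"
    by (rule SUP_least)
  also have "\<dots> < \<infinity>" by (simp add: ennreal_mult_less_top)
  finally show ?thesis .
qed

theorem lemma5:
  fixes A :: "real^'d^'d" and B :: "real^'m^'d" and k :: nat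
    and M :: "'a measure" and w :: "nat \<Rightarrow> 'a \<Rightarrow> real^'d"
    and Q :: "nat \<Rightarrow> real^'d^'d" and C4 :: real
  assumes "orthogonal_matrix A"
    and "reachable_in A B k"
    and "prob_space M"
    and "\<And>t. w t \<in> borel_measurable M"
    and "prob_space.indep_vars M (\<lambda>_. borel) w UNIV"
    and "\<And>t. integrable M (w t)"
    and "\<And>t. (\<integral>\<omega>. w t \<omega> \<partial>M) = 0"
    and "\<And>t i j. integrable M (\<lambda>\<omega>. w t \<omega> $ i * w t \<omega> $ j)"
    and "\<And>t i j. (\<integral>\<omega>. w t \<omega> $ i * w t \<omega> $ j \<partial>M) = Q t $ i $ j"
    and "C4 > 0"
    and "\<And>t. (\<integral>\<^sup>+\<omega>. ennreal (norm (w t \<omega>) ^ 4) \<partial>M) \<le> ennreal C4"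
  shows "\<exists>\<rho>::real. \<rho> > 0 \<and> (\<exists>f :: nat \<Rightarrow> real^'d \<Rightarrow> real^'m.
           (\<forall>i<k. f i \<in> borel_measurable borel) \<and>
           (\<forall>i<k. \<forall>x. norm (f i x) \<le> \<rho>) \<and>
           (\<forall>x. (SUP t. \<integral>\<^sup>+\<omega>. ennreal (norm (closed_loop A B k f w x t \<omega>) ^ 2) \<partial>M) < \<infinity>))"
proof -
  have k: "0 < k"
  proof (rule ccontr)
    assume "\<not> 0 < k"
    with assms(2) show False by (simp add: reachable_in_def reach_rank_def)
  qed
  obtain f :: "nat \<Rightarrow> real^'d \<Rightarrow> real^'m" and \<rho> where "0 < \<rho>"
    and f: "\<And>i. f i \<in> borel_measurable borel" and bounded: "\<And>i x. i < k \<Longrightarrow> norm (f i x) \<le> \<rho>"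
    and contracts: "\<And>x. norm (matpow A k *v x + (\<Sum>i<k. matpow A (k - 1 - i) *v (B *v f i x)))
      \<le> max (norm x - (real k ^ 4 * C4 + 2)) 0"
    using block_controller_exists[OF assms(1,2), of "real k ^ 4 * C4 + 2"] assms(10) by force
  have "(SUP t. \<integral>\<^sup>+\<omega>. ennreal (norm (closed_loop A B k f w x t \<omega>) ^ 2) \<partial>M) < \<infinity>" for x
    using assms(10) by (intro closed_loop_second_moment_bounded[OF assms(1) k assms(3-5) _ assms(11)
        f bounded contracts]) simp
  with \<open>0 < \<rho>\<close> f bounded show ?thesis by blast
qed

end
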